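(* If a raw type theory derives that $\Theta$ is a well-formed metavariable context, that $\Gamma$ is a well-formed variable context over $\Theta$, and $\Theta;\Gamma\vdash\mathcal{B}[e]$, then it derives $\Theta;\Gamma\vdash\mathcal{B}$.
   Context: Setting: finitary type theories with hypothetical judgements $\Theta;\Gamma\vdash\mathcal{J}$ (metavariable context $\Theta$, variable context $\Gamma$, abstracted judgement $\mathcal{J}$). A boundary $\mathcal{B}$ is a judgement with its head replaced by a placeholder: $\Box\ \mathsf{type}$, $\Box:A$, $A\equiv B$ by $\Box$, $s\equiv t:A$ by $\Box$, possibly under abstractions $\{x:A\}\mathcal{B}$; $\mathcal{B}[e]$ fills the placeholder with head $e$, and every judgement is uniquely of this form. Boundaries are derived by: $\Box\ \mathsf{type}$ always; $\Box:A$ from $A\ \mathsf{type}$; $A\equiv B$ by $\Box$ from $A\ \mathsf{type}$ and $B\ \mathsf{type}$; $s\equiv t:A$ by $\Box$ from $A\ \mathsf{type}$, $s:A$, $t:A$; and an abstraction rule. Well-formedness: the empty metavariable context is well-formed, and $\Theta,\mathsf{M}:\mathcal{B}$ is well-formed if $\Theta$ is, $\Theta;\emptyset\vdash\mathcal{B}$ and $\mathsf{M}$ is fresh; the empty variable context is well-formed over $\Theta$, and $\Gamma,\mathsf{a}:A$ is well-formed if $\Gamma$ is, $\Theta;\Gamma\vdash A\ \mathsf{type}$ and $\mathsf{a}$ is fresh. A raw type theory is a family of raw rules with deductive system given by structural rules, instantiations of specific rules (which include the instantiated conclusion boundary as a premise), and congruence rules for specific object rules. *)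

theory Defs
  imports Main "HOL-Library.Infinite_Typeclass"
begin

section \<open>Raw syntax\<close>

datatype cls = Ty | Tm | EqTy | EqTm

text \<open>An argument or metavariable arity \<open>(c, n)\<close> stands for syntactic class \<open>c\<close> with \<open>n\<close>
  bound variables (respectively \<open>n\<close> term arguments).\<close>

type_synonym arity = "cls \<times> nat"
type_synonym 's signat = "'s \<Rightarrow> (cls \<times> arity list) option"

definition obj_cls :: "cls \<Rightarrow> bool" where
  "obj_cls c \<longleftrightarrow> c = Ty \<or> c = Tm"

definition wf_signat :: "'s signat \<Rightarrow> bool" where
  "wf_signat \<Sigma> \<longleftrightarrow> (\<forall>S c \<alpha>s. \<Sigma> S = Some (c, \<alpha>s) \<longrightarrow> obj_cls c)"

text \<open>Free variables are names, bound variables are de Bruijn indices; \<open>Lam e\<close> is the abstracted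
  argument \<open>{x}e\<close>. Type expressions, term expressions and arguments share one datatype and are
  told apart by \<open>wf_expr\<close> below.\<close>

datatype ('s, 'm, 'v) expr =
    Free 'v
  | Bound nat
  | Sym 's "('s, 'm, 'v) expr list"
  | Meta 'm "('s, 'm, 'v) expr list"
  | StarTy
  | StarTm
  | Lam "('s, 'm, 'v) expr"

datatype 'e jthesis =
    IsTy 'e                     \<comment> \<open>\<open>A type\<close>\<close>
  | HasTy 'e 'e                 \<comment> \<open>\<open>t : A\<close>\<close>
  | EquTy 'e 'e                 \<comment> \<open>\<open>A \<equiv> B by \<star>\<close>\<close>
  | EquTm 'e 'e 'e              \<comment> \<open>\<open>s \<equiv> t : A by \<star>\<close>\<close>

datatype 'e bthesis =
    BTy                         \<comment> \<open>\<open>\<box> type\<close>\<close>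
  | BTm 'e                      \<comment> \<open>\<open>\<box> : A\<close>\<close>
  | BEquTy 'e 'e                \<comment> \<open>\<open>A \<equiv> B by \<box>\<close>\<close>
  | BEquTm 'e 'e 'e             \<comment> \<open>\<open>s \<equiv> t : A by \<box>\<close>\<close>

text \<open>\<open>Abstr A X\<close> is \<open>{x:A}X\<close>; the bound variable has index 0 in \<open>X\<close>.\<close>

datatype ('e, 't) abstracted = Plain 't | Abstr 'e "('e, 't) abstracted"

type_synonym ('s, 'm, 'v) judgement =
  "(('s, 'm, 'v) expr, ('s, 'm, 'v) expr jthesis) abstracted"
type_synonym ('s, 'm, 'v) boundary =
  "(('s, 'm, 'v) expr, ('s, 'm, 'v) expr bthesis) abstracted"

text \<open>Contexts are listed in order of declaration, so that extension appends at the end.\<close>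

type_synonym ('s, 'm, 'v) mctx = "('m \<times> ('s, 'm, 'v) boundary) list"
type_synonym ('s, 'm, 'v) vctx = "('v \<times> ('s, 'm, 'v) expr) list"

definition ctx_dom :: "('a \<times> 'b) list \<Rightarrow> 'a set" where
  "ctx_dom \<Gamma> = fst ` set \<Gamma>"


fun bthesis_cls :: "'e bthesis \<Rightarrow> cls" where
  "bthesis_cls BTy = Ty"
| "bthesis_cls (BTm A) = Tm"
| "bthesis_cls (BEquTy A B) = EqTy"
| "bthesis_cls (BEquTm s t A) = EqTm"

fun bdry_arity :: "('e, 'e bthesis) abstracted \<Rightarrow> arity" where
  "bdry_arity (Plain b) = (bthesis_cls b, 0)"
| "bdry_arity (Abstr A B) = (fst (bdry_arity B), Suc (snd (bdry_arity B)))"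

definition obj_bdry :: "('e, 'e bthesis) abstracted \<Rightarrow> bool" where
  "obj_bdry B \<longleftrightarrow> obj_cls (fst (bdry_arity B))"

definition mctx_arity :: "('s, 'm, 'v) mctx \<Rightarrow> 'm \<Rightarrow> arity option" where
  "mctx_arity \<Theta> M = map_option bdry_arity (map_of \<Theta> M)"


subsection \<open>Syntactic validity\<close>

text \<open>\<open>wf_expr \<Sigma> \<mu> V k (c, n) e\<close>: over the signature \<open>\<Sigma>\<close>, metavariables with arities \<open>\<mu>\<close> and free
  variables \<open>V\<close>, and inside \<open>k\<close> binders, \<open>e\<close> is an expression of class \<open>c\<close> under \<open>n\<close>
  abstractions. This is purely syntactic and involves no derivability. Metavariables of equational
  class never occur in expressions: an equational argument is a dummy.\<close>

inductive wf_expr ::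
    "'s signat \<Rightarrow> ('m \<Rightarrow> arity option) \<Rightarrow> 'v set \<Rightarrow> nat \<Rightarrow> arity \<Rightarrow> ('s, 'm, 'v) expr \<Rightarrow> bool"
  for \<Sigma> \<mu> V where
  "a \<in> V \<Longrightarrow> wf_expr \<Sigma> \<mu> V k (Tm, 0) (Free a)"
| "i < k \<Longrightarrow> wf_expr \<Sigma> \<mu> V k (Tm, 0) (Bound i)"
| "\<Sigma> S = Some (c, \<alpha>s) \<Longrightarrow> list_all2 (wf_expr \<Sigma> \<mu> V k) \<alpha>s es \<Longrightarrow> wf_expr \<Sigma> \<mu> V k (c, 0) (Sym S es)"
| "\<mu> M = Some (c, n) \<Longrightarrow> obj_cls c \<Longrightarrow> length ts = n \<Longrightarrow> list_all (wf_expr \<Sigma> \<mu> V k (Tm, 0)) ts \<Longrightarrow>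
     wf_expr \<Sigma> \<mu> V k (c, 0) (Meta M ts)"
| "wf_expr \<Sigma> \<mu> V k (EqTy, 0) StarTy"
| "wf_expr \<Sigma> \<mu> V k (EqTm, 0) StarTm"
| "wf_expr \<Sigma> \<mu> V (Suc k) (c, n) e \<Longrightarrow> wf_expr \<Sigma> \<mu> V k (c, Suc n) (Lam e)"

fun wf_jthesis ::
    "'s signat \<Rightarrow> ('m \<Rightarrow> arity option) \<Rightarrow> 'v set \<Rightarrow> nat \<Rightarrow> ('s, 'm, 'v) expr jthesis \<Rightarrow> bool" where
  "wf_jthesis \<Sigma> \<mu> V k (IsTy A) \<longleftrightarrow> wf_expr \<Sigma> \<mu> V k (Ty, 0) A"
| "wf_jthesis \<Sigma> \<mu> V k (HasTy t A) \<longleftrightarrow> wf_expr \<Sigma> \<mu> V k (Tm, 0) t \<and> wf_expr \<Sigma> \<mu> V k (Ty, 0) A"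
| "wf_jthesis \<Sigma> \<mu> V k (EquTy A B) \<longleftrightarrow> wf_expr \<Sigma> \<mu> V k (Ty, 0) A \<and> wf_expr \<Sigma> \<mu> V k (Ty, 0) B"
| "wf_jthesis \<Sigma> \<mu> V k (EquTm s t A) \<longleftrightarrow>
     wf_expr \<Sigma> \<mu> V k (Tm, 0) s \<and> wf_expr \<Sigma> \<mu> V k (Tm, 0) t \<and> wf_expr \<Sigma> \<mu> V k (Ty, 0) A"

fun wf_bthesis ::
    "'s signat \<Rightarrow> ('m \<Rightarrow> arity option) \<Rightarrow> 'v set \<Rightarrow> nat \<Rightarrow> ('s, 'm, 'v) expr bthesis \<Rightarrow> bool" where
  "wf_bthesis \<Sigma> \<mu> V k BTy \<longleftrightarrow> True"
| "wf_bthesis \<Sigma> \<mu> V k (BTm A) \<longleftrightarrow> wf_expr \<Sigma> \<mu> V k (Ty, 0) A"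
| "wf_bthesis \<Sigma> \<mu> V k (BEquTy A B) \<longleftrightarrow> wf_expr \<Sigma> \<mu> V k (Ty, 0) A \<and> wf_expr \<Sigma> \<mu> V k (Ty, 0) B"
| "wf_bthesis \<Sigma> \<mu> V k (BEquTm s t A) \<longleftrightarrow>
     wf_expr \<Sigma> \<mu> V k (Tm, 0) s \<and> wf_expr \<Sigma> \<mu> V k (Tm, 0) t \<and> wf_expr \<Sigma> \<mu> V k (Ty, 0) A"

fun wf_judgement ::
    "'s signat \<Rightarrow> ('m \<Rightarrow> arity option) \<Rightarrow> 'v set \<Rightarrow> nat \<Rightarrow> ('s, 'm, 'v) judgement \<Rightarrow> bool" where
  "wf_judgement \<Sigma> \<mu> V k (Plain j) \<longleftrightarrow> wf_jthesis \<Sigma> \<mu> V k j"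
| "wf_judgement \<Sigma> \<mu> V k (Abstr A J) \<longleftrightarrow> wf_expr \<Sigma> \<mu> V k (Ty, 0) A \<and> wf_judgement \<Sigma> \<mu> V (Suc k) J"

fun wf_boundary ::
    "'s signat \<Rightarrow> ('m \<Rightarrow> arity option) \<Rightarrow> 'v set \<Rightarrow> nat \<Rightarrow> ('s, 'm, 'v) boundary \<Rightarrow> bool" where
  "wf_boundary \<Sigma> \<mu> V k (Plain b) \<longleftrightarrow> wf_bthesis \<Sigma> \<mu> V k b"
| "wf_boundary \<Sigma> \<mu> V k (Abstr A B) \<longleftrightarrow> wf_expr \<Sigma> \<mu> V k (Ty, 0) A \<and> wf_boundary \<Sigma> \<mu> V (Suc k) B"

definition wf_mctx :: "'s signat \<Rightarrow> ('s, 'm, 'v) mctx \<Rightarrow> bool" where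
  "wf_mctx \<Sigma> \<Theta> \<longleftrightarrow> distinct (map fst \<Theta>) \<and>
     (\<forall>i < length \<Theta>. wf_boundary \<Sigma> (mctx_arity (take i \<Theta>)) {} 0 (snd (\<Theta> ! i)))"

definition wf_vctx :: "'s signat \<Rightarrow> ('s, 'm, 'v) mctx \<Rightarrow> ('s, 'm, 'v) vctx \<Rightarrow> bool" where
  "wf_vctx \<Sigma> \<Theta> \<Gamma> \<longleftrightarrow> distinct (map fst \<Gamma>) \<and>
     (\<forall>i < length \<Gamma>. wf_expr \<Sigma> (mctx_arity \<Theta>) (ctx_dom (take i \<Gamma>)) 0 (Ty, 0) (snd (\<Gamma> ! i)))"


subsection \<open>Substitution for bound variables\<close>

fun lift :: "nat \<Rightarrow> ('s, 'm, 'v) expr \<Rightarrow> ('s, 'm, 'v) expr" where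
  "lift k (Free a) = Free a"
| "lift k (Bound i) = Bound (if i < k then i else Suc i)"
| "lift k (Sym S es) = Sym S (map (lift k) es)"
| "lift k (Meta M ts) = Meta M (map (lift k) ts)"
| "lift k StarTy = StarTy"
| "lift k StarTm = StarTm"
| "lift k (Lam e) = Lam (lift (Suc k) e)"

definition up :: "(nat \<Rightarrow> ('s, 'm, 'v) expr) \<Rightarrow> nat \<Rightarrow> ('s, 'm, 'v) expr" where
  "up \<sigma> = case_nat (Bound 0) (\<lambda>i. lift 0 (\<sigma> i))"

fun bsubst :: "(nat \<Rightarrow> ('s, 'm, 'v) expr) \<Rightarrow> ('s, 'm, 'v) expr \<Rightarrow> ('s, 'm, 'v) expr" where
  "bsubst \<sigma> (Free a) = Free a"
| "bsubst \<sigma> (Bound i) = \<sigma> i"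
| "bsubst \<sigma> (Sym S es) = Sym S (map (bsubst \<sigma>) es)"
| "bsubst \<sigma> (Meta M ts) = Meta M (map (bsubst \<sigma>) ts)"
| "bsubst \<sigma> StarTy = StarTy"
| "bsubst \<sigma> StarTm = StarTm"
| "bsubst \<sigma> (Lam e) = Lam (bsubst (up \<sigma>) e)"

fun bsubst_judgement ::
    "(nat \<Rightarrow> ('s, 'm, 'v) expr) \<Rightarrow> ('s, 'm, 'v) judgement \<Rightarrow> ('s, 'm, 'v) judgement" where
  "bsubst_judgement \<sigma> (Plain j) = Plain (map_jthesis (bsubst \<sigma>) j)"
| "bsubst_judgement \<sigma> (Abstr A J) = Abstr (bsubst \<sigma> A) (bsubst_judgement (up \<sigma>) J)"

fun bsubst_boundary ::
    "(nat \<Rightarrow> ('s, 'm, 'v) expr) \<Rightarrow> ('s, 'm, 'v) boundary \<Rightarrow> ('s, 'm, 'v) boundary" where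
  "bsubst_boundary \<sigma> (Plain b) = Plain (map_bthesis (bsubst \<sigma>) b)"
| "bsubst_boundary \<sigma> (Abstr A B) = Abstr (bsubst \<sigma> A) (bsubst_boundary (up \<sigma>) B)"

text \<open>\<open>tms [t\<^sub>1,\<dots>,t\<^sub>m]\<close> is the substitution \<open>[t\<^sub>1/x\<^sub>1,\<dots>,t\<^sub>m/x\<^sub>m]\<close> for the \<open>m\<close> innermost
  enclosing binders, of which \<open>x\<^sub>1\<close> is the outermost; hence the reversal.\<close>

definition tms :: "('s, 'm, 'v) expr list \<Rightarrow> nat \<Rightarrow> ('s, 'm, 'v) expr" where
  "tms ts i = (if i < length ts then rev ts ! i else Bound (i - length ts))"


subsection \<open>Filling boundaries\<close>

text \<open>The head of an equational judgement is always the dummy, so the head supplied for an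
  equational boundary is not recorded.\<close>

fun fill_thesis :: "'e bthesis \<Rightarrow> 'e \<Rightarrow> 'e jthesis" where
  "fill_thesis BTy e = IsTy e"
| "fill_thesis (BTm A) e = HasTy e A"
| "fill_thesis (BEquTy A B) e = EquTy A B"
| "fill_thesis (BEquTm s t A) e = EquTm s t A"

text \<open>\<open>fill\<close> is total: when the number of abstractions of the head does not match, the filling is
  still some judgement with the given boundary.\<close>

fun body :: "('s, 'm, 'v) expr \<Rightarrow> ('s, 'm, 'v) expr" where
  "body (Lam e) = e"
| "body e = e"

fun fill :: "('s, 'm, 'v) boundary \<Rightarrow> ('s, 'm, 'v) expr \<Rightarrow> ('s, 'm, 'v) judgement" where
  "fill (Plain b) e = Plain (fill_thesis b e)"
| "fill (Abstr A B) e = Abstr A (fill B (body e))"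

lemma wf_dummy:
  "wf_signat \<Sigma> \<Longrightarrow> wf_expr \<Sigma> \<mu> V k (c, 0) e \<Longrightarrow> \<not> obj_cls c \<Longrightarrow>
     e = (if c = EqTy then StarTy else StarTm)"
  by (erule wf_expr.cases) (auto simp: wf_signat_def obj_cls_def)

text \<open>Every judgement is the filling of a unique boundary by a unique head.\<close>

lemma fill_exists:
  "wf_judgement \<Sigma> \<mu> V k J \<Longrightarrow>
     \<exists>B e. wf_boundary \<Sigma> \<mu> V k B \<and> wf_expr \<Sigma> \<mu> V k (bdry_arity B) e \<and> J = fill B e"
proof (induction J arbitrary: k)
  case (Plain j)
  have "\<exists>b e. wf_bthesis \<Sigma> \<mu> V k b \<and> wf_expr \<Sigma> \<mu> V k (bthesis_cls b, 0) e \<and> j = fill_thesis b e"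
  proof (cases j)
    case (IsTy A)
    with Plain show ?thesis by (intro exI[of _ BTy] exI[of _ A]) auto
  next
    case (HasTy t A)
    with Plain show ?thesis by (intro exI[of _ "BTm A"] exI[of _ t]) auto
  next
    case (EquTy A B)
    with Plain show ?thesis
      by (intro exI[of _ "BEquTy A B"] exI[of _ StarTy]) (auto intro: wf_expr.intros)
  next
    case (EquTm s t A)
    with Plain show ?thesis
      by (intro exI[of _ "BEquTm s t A"] exI[of _ StarTm]) (auto intro: wf_expr.intros)
  qed
  then obtain b e
    where "wf_bthesis \<Sigma> \<mu> V k b" "wf_expr \<Sigma> \<mu> V k (bthesis_cls b, 0) e" "j = fill_thesis b e"
    by blast
  then show ?case by (intro exI[of _ "Plain b"] exI[of _ e]) auto
next
  case (Abstr A J)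
  then obtain B e
    where "wf_boundary \<Sigma> \<mu> V (Suc k) B" "wf_expr \<Sigma> \<mu> V (Suc k) (bdry_arity B) e" "J = fill B e"
    by fastforce
  with Abstr.prems show ?case
    by (intro exI[of _ "Abstr A B"] exI[of _ "Lam e"]) (auto intro: wf_expr.intros)
qed

lemma fill_unique:
  "wf_signat \<Sigma> \<Longrightarrow> wf_expr \<Sigma> \<mu> V k (bdry_arity B) e \<Longrightarrow> wf_expr \<Sigma> \<mu> V k (bdry_arity B') e' \<Longrightarrow>
     fill B e = fill B' e' \<Longrightarrow> B = B' \<and> e = e'"
proof (induction B arbitrary: k e B' e')
  case (Plain b)
  then obtain b' where B': "B' = Plain b'" by (cases B') auto
  show ?case
    using Plain wf_dummy[of \<Sigma> \<mu> V k _ e] wf_dummy[of \<Sigma> \<mu> V k _ e'] unfolding B'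
    by (cases b; cases b') (auto simp: obj_cls_def)
next
  case (Abstr A B)
  from Abstr.prems obtain A2 B2 where B': "B' = Abstr A2 B2" by (cases B') auto
  from Abstr.prems(2) obtain f where f: "e = Lam f" "wf_expr \<Sigma> \<mu> V (Suc k) (bdry_arity B) f"
    by (cases rule: wf_expr.cases) auto
  from Abstr.prems(3) B' obtain g where g: "e' = Lam g" "wf_expr \<Sigma> \<mu> V (Suc k) (bdry_arity B2) g"
    by (auto elim: wf_expr.cases)
  show ?case using Abstr.IH[OF Abstr.prems(1) f(2) g(2)] Abstr.prems(4) f(1) g(1) B' by auto
qed

text \<open>Filling an object boundary with an equation \<open>e \<equiv> e'\<close>; it is only used for object
  boundaries, and its value on the others is irrelevant.\<close>

fun fill_eq_thesis :: "'e bthesis \<Rightarrow> 'e \<Rightarrow> 'e \<Rightarrow> 'e jthesis" where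
  "fill_eq_thesis BTy e e' = EquTy e e'"
| "fill_eq_thesis (BTm A) e e' = EquTm e e' A"
| "fill_eq_thesis b e e' = undefined"

fun fill_eq ::
    "('s, 'm, 'v) boundary \<Rightarrow> ('s, 'm, 'v) expr \<Rightarrow> ('s, 'm, 'v) expr \<Rightarrow> ('s, 'm, 'v) judgement" where
  "fill_eq (Plain b) e e' = Plain (fill_eq_thesis b e e')"
| "fill_eq (Abstr A B) e e' = Abstr A (fill_eq B (body e) (body e'))"


subsection \<open>Instantiations of metavariables\<close>

fun strip :: "nat \<Rightarrow> ('s, 'm, 'v) expr \<Rightarrow> ('s, 'm, 'v) expr" where
  "strip 0 e = e"
| "strip (Suc n) e = strip n (body e)"

text \<open>\<open>M(t\<^sub>1,\<dots>,t\<^sub>k)\<close> with \<open>M \<mapsto> {x\<^sub>1}\<dots>{x\<^sub>k}e\<close> becomes \<open>e[I\<^sub>*t\<^sub>1/x\<^sub>1,\<dots>,I\<^sub>*t\<^sub>k/x\<^sub>k]\<close>. The arguments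
  in an instantiation have no dangling indices, so \<open>I\<close> is not shifted under binders.\<close>

fun act :: "('m \<Rightarrow> ('s, 'm, 'v) expr option) \<Rightarrow> ('s, 'm, 'v) expr \<Rightarrow> ('s, 'm, 'v) expr" where
  "act I (Free a) = Free a"
| "act I (Bound i) = Bound i"
| "act I (Sym S es) = Sym S (map (act I) es)"
| "act I (Meta M ts) =
     (case I M of
        None \<Rightarrow> Meta M (map (act I) ts)
      | Some e \<Rightarrow> bsubst (tms (map (act I) ts)) (strip (length ts) e))"
| "act I StarTy = StarTy"
| "act I StarTm = StarTm"
| "act I (Lam e) = Lam (act I e)"

fun act_boundary ::
    "('m \<Rightarrow> ('s, 'm, 'v) expr option) \<Rightarrow> ('s, 'm, 'v) boundary \<Rightarrow> ('s, 'm, 'v) boundary" where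
  "act_boundary I (Plain b) = Plain (map_bthesis (act I) b)"
| "act_boundary I (Abstr A B) = Abstr (act I A) (act_boundary I B)"

text \<open>An instantiation of \<open>\<Xi>\<close> is a list of arguments, matched with the metavariables of \<open>\<Xi>\<close>
  by position; \<open>inst_map (take i \<Xi>) fs\<close> is its restriction \<open>I\<^sub>(\<^sub>i\<^sub>)\<close> to the first \<open>i\<close> of them.\<close>

definition inst_map ::
    "('s, 'm, 'v) mctx \<Rightarrow> ('s, 'm, 'v) expr list \<Rightarrow> 'm \<Rightarrow> ('s, 'm, 'v) expr option" where
  "inst_map \<Xi> fs = map_of (zip (map fst \<Xi>) fs)"

definition instantiation_of ::
    "'s signat \<Rightarrow> ('s, 'm, 'v) mctx \<Rightarrow> ('s, 'm, 'v) vctx \<Rightarrow> ('s, 'm, 'v) mctx \<Rightarrow>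
     ('s, 'm, 'v) expr list \<Rightarrow> bool" where
  "instantiation_of \<Sigma> \<Theta> \<Gamma> \<Xi> fs \<longleftrightarrow>
     list_all2 (\<lambda>(M, B) f. wf_expr \<Sigma> (mctx_arity \<Theta>) (ctx_dom \<Gamma>) 0 (bdry_arity B) f) \<Xi> fs"

definition inst_bdry ::
    "('s, 'm, 'v) mctx \<Rightarrow> ('s, 'm, 'v) expr list \<Rightarrow> nat \<Rightarrow> ('s, 'm, 'v) boundary" where
  "inst_bdry \<Xi> fs i = act_boundary (inst_map (take i \<Xi>) fs) (snd (\<Xi> ! i))"


section \<open>Raw type theories\<close>

datatype ('s, 'm, 'v) hyp =
    Judg "('s, 'm, 'v) mctx" "('s, 'm, 'v) vctx" "('s, 'm, 'v) judgement"
  | Bdry "('s, 'm, 'v) mctx" "('s, 'm, 'v) vctx" "('s, 'm, 'v) boundary"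

fun wf_hyp :: "'s signat \<Rightarrow> ('s, 'm, 'v) hyp \<Rightarrow> bool" where
  "wf_hyp \<Sigma> (Judg \<Theta> \<Gamma> J) \<longleftrightarrow>
     wf_mctx \<Sigma> \<Theta> \<and> wf_vctx \<Sigma> \<Theta> \<Gamma> \<and> wf_judgement \<Sigma> (mctx_arity \<Theta>) (ctx_dom \<Gamma>) 0 J"
| "wf_hyp \<Sigma> (Bdry \<Theta> \<Gamma> B) \<longleftrightarrow>
     wf_mctx \<Sigma> \<Theta> \<and> wf_vctx \<Sigma> \<Theta> \<Gamma> \<and> wf_boundary \<Sigma> (mctx_arity \<Theta>) (ctx_dom \<Gamma>) 0 B"

text \<open>A raw rule \<open>\<Xi> \<Longrightarrow> j\<close> is a hypothetical judgement \<open>\<Xi>; \<emptyset> \<turnstile> j\<close> without abstractions.\<close>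

type_synonym ('s, 'm, 'v) raw_rule = "('s, 'm, 'v) mctx \<times> ('s, 'm, 'v) expr jthesis"

definition raw_type_theory :: "'s signat \<Rightarrow> ('s, 'm, 'v) raw_rule set \<Rightarrow> bool" where
  "raw_type_theory \<Sigma> R \<longleftrightarrow> wf_signat \<Sigma> \<and> (\<forall>(\<Xi>, j) \<in> R. wf_hyp \<Sigma> (Judg \<Xi> [] (Plain j)))"

text \<open>The closure rules of the deductive system of a raw type theory: a list of premises and a
  conclusion.\<close>

inductive closure_rule ::
    "'s signat \<Rightarrow> ('s, 'm, 'v) raw_rule set \<Rightarrow> ('s, 'm, 'v) hyp list \<Rightarrow> ('s, 'm, 'v) hyp \<Rightarrow> bool"
  for \<Sigma> R where
  TT_Var:
    "(a, A) \<in> set \<Gamma> \<Longrightarrow>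
     closure_rule \<Sigma> R [] (Judg \<Theta> \<Gamma> (Plain (HasTy (Free a) A)))"
| TT_Meta:
    "(M, foldr Abstr As (Plain b)) \<in> set \<Theta> \<Longrightarrow> length ts = length As \<Longrightarrow>
     closure_rule \<Sigma> R
       (map (\<lambda>j. Judg \<Theta> \<Gamma> (Plain (HasTy (ts ! j) (bsubst (tms (take j ts)) (As ! j)))))
          [0..<length As] @
        [Bdry \<Theta> \<Gamma> (Plain (map_bthesis (bsubst (tms ts)) b))])
       (Judg \<Theta> \<Gamma> (Plain (fill_thesis (map_bthesis (bsubst (tms ts)) b) (Meta M ts))))"
| TT_Meta_Congr:
    "(M, foldr Abstr As (Plain b)) \<in> set \<Theta> \<Longrightarrow> obj_cls (bthesis_cls b) \<Longrightarrow>
     length ss = length As \<Longrightarrow> length ts = length As \<Longrightarrow>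
     closure_rule \<Sigma> R
       (map (\<lambda>j. Judg \<Theta> \<Gamma> (Plain (HasTy (ss ! j) (bsubst (tms (take j ss)) (As ! j)))))
          [0..<length As] @
        map (\<lambda>j. Judg \<Theta> \<Gamma> (Plain (HasTy (ts ! j) (bsubst (tms (take j ts)) (As ! j)))))
          [0..<length As] @
        map (\<lambda>j. Judg \<Theta> \<Gamma> (Plain (EquTm (ss ! j) (ts ! j) (bsubst (tms (take j ss)) (As ! j)))))
          [0..<length As] @
        (case b of
           BTm C \<Rightarrow> [Judg \<Theta> \<Gamma> (Plain (EquTy (bsubst (tms ss) C) (bsubst (tms ts) C)))]
         | _ \<Rightarrow> []))
       (Judg \<Theta> \<Gamma> (Plain (fill_eq_thesis (map_bthesis (bsubst (tms ss)) b) (Meta M ss) (Meta M ts))))"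
| TT_Abstr:
    "a \<notin> ctx_dom \<Gamma> \<Longrightarrow>
     closure_rule \<Sigma> R
       [Judg \<Theta> \<Gamma> (Plain (IsTy A)), Judg \<Theta> (\<Gamma> @ [(a, A)]) (bsubst_judgement (tms [Free a]) J)]
       (Judg \<Theta> \<Gamma> (Abstr A J))"
| TT_Ty_Refl:
    "closure_rule \<Sigma> R [Judg \<Theta> \<Gamma> (Plain (IsTy A))] (Judg \<Theta> \<Gamma> (Plain (EquTy A A)))"
| TT_Ty_Sym:
    "closure_rule \<Sigma> R [Judg \<Theta> \<Gamma> (Plain (EquTy A B))] (Judg \<Theta> \<Gamma> (Plain (EquTy B A)))"
| TT_Ty_Tran:
    "closure_rule \<Sigma> R
       [Judg \<Theta> \<Gamma> (Plain (EquTy A B)), Judg \<Theta> \<Gamma> (Plain (EquTy B C))]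
       (Judg \<Theta> \<Gamma> (Plain (EquTy A C)))"
| TT_Tm_Refl:
    "closure_rule \<Sigma> R [Judg \<Theta> \<Gamma> (Plain (HasTy t A))] (Judg \<Theta> \<Gamma> (Plain (EquTm t t A)))"
| TT_Tm_Sym:
    "closure_rule \<Sigma> R [Judg \<Theta> \<Gamma> (Plain (EquTm s t A))] (Judg \<Theta> \<Gamma> (Plain (EquTm t s A)))"
| TT_Tm_Tran:
    "closure_rule \<Sigma> R
       [Judg \<Theta> \<Gamma> (Plain (EquTm s t A)), Judg \<Theta> \<Gamma> (Plain (EquTm t u A))]
       (Judg \<Theta> \<Gamma> (Plain (EquTm s u A)))"
| TT_Conv_Tm:
    "closure_rule \<Sigma> R
       [Judg \<Theta> \<Gamma> (Plain (HasTy t A)), Judg \<Theta> \<Gamma> (Plain (EquTy A B))]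
       (Judg \<Theta> \<Gamma> (Plain (HasTy t B)))"
| TT_Conv_EqTm:
    "closure_rule \<Sigma> R
       [Judg \<Theta> \<Gamma> (Plain (EquTm s t A)), Judg \<Theta> \<Gamma> (Plain (EquTy A B))]
       (Judg \<Theta> \<Gamma> (Plain (EquTm s t B)))"
| TT_Bdry_Ty:
    "closure_rule \<Sigma> R [] (Bdry \<Theta> \<Gamma> (Plain BTy))"
| TT_Bdry_Tm:
    "closure_rule \<Sigma> R [Judg \<Theta> \<Gamma> (Plain (IsTy A))] (Bdry \<Theta> \<Gamma> (Plain (BTm A)))"
| TT_Bdry_EqTy:
    "closure_rule \<Sigma> R
       [Judg \<Theta> \<Gamma> (Plain (IsTy A)), Judg \<Theta> \<Gamma> (Plain (IsTy B))]
       (Bdry \<Theta> \<Gamma> (Plain (BEquTy A B)))"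
| TT_Bdry_EqTm:
    "closure_rule \<Sigma> R
       [Judg \<Theta> \<Gamma> (Plain (IsTy A)), Judg \<Theta> \<Gamma> (Plain (HasTy s A)), Judg \<Theta> \<Gamma> (Plain (HasTy t A))]
       (Bdry \<Theta> \<Gamma> (Plain (BEquTm s t A)))"
| TT_Bdry_Abstr:
    "a \<notin> ctx_dom \<Gamma> \<Longrightarrow>
     closure_rule \<Sigma> R
       [Judg \<Theta> \<Gamma> (Plain (IsTy A)), Bdry \<Theta> (\<Gamma> @ [(a, A)]) (bsubst_boundary (tms [Free a]) B)]
       (Bdry \<Theta> \<Gamma> (Abstr A B))"
| Specific:
    "(\<Xi>, fill_thesis b e) \<in> R \<Longrightarrow> instantiation_of \<Sigma> \<Theta> \<Gamma> \<Xi> fs \<Longrightarrow>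
     closure_rule \<Sigma> R
       (map (\<lambda>i. Judg \<Theta> \<Gamma> (fill (inst_bdry \<Xi> fs i) (fs ! i))) [0..<length \<Xi>] @
        [Bdry \<Theta> \<Gamma> (Plain (map_bthesis (act (inst_map \<Xi> fs)) b))])
       (Judg \<Theta> \<Gamma> (Plain (map_jthesis (act (inst_map \<Xi> fs)) (fill_thesis b e))))"
| Congruence:
    "(\<Xi>, fill_thesis b e) \<in> R \<Longrightarrow> obj_cls (bthesis_cls b) \<Longrightarrow>
     instantiation_of \<Sigma> \<Theta> \<Gamma> \<Xi> fs \<Longrightarrow> instantiation_of \<Sigma> \<Theta> \<Gamma> \<Xi> gs \<Longrightarrow>
     closure_rule \<Sigma> R
       (map (\<lambda>i. Judg \<Theta> \<Gamma> (fill (inst_bdry \<Xi> fs i) (fs ! i))) [0..<length \<Xi>] @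
        map (\<lambda>i. Judg \<Theta> \<Gamma> (fill (inst_bdry \<Xi> gs i) (gs ! i))) [0..<length \<Xi>] @
        map (\<lambda>i. Judg \<Theta> \<Gamma> (fill_eq (inst_bdry \<Xi> fs i) (fs ! i) (gs ! i)))
          (filter (\<lambda>i. obj_bdry (snd (\<Xi> ! i))) [0..<length \<Xi>]) @
        (case b of
           BTm B \<Rightarrow> [Judg \<Theta> \<Gamma> (Plain (EquTy (act (inst_map \<Xi> fs) B) (act (inst_map \<Xi> gs) B)))]
         | _ \<Rightarrow> []))
       (Judg \<Theta> \<Gamma> (Plain (fill_eq_thesis (map_bthesis (act (inst_map \<Xi> fs)) b)
          (act (inst_map \<Xi> fs) e) (act (inst_map \<Xi> gs) e))))"

text \<open>The closure rules are rules on syntactically valid hypothetical judgements and boundaries.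
  Premises that are derivable are valid already, so it suffices to guard the conclusion.\<close>

inductive derives ::
    "'s signat \<Rightarrow> ('s, 'm, 'v) raw_rule set \<Rightarrow> ('s, 'm, 'v) hyp \<Rightarrow> bool"
  for \<Sigma> R where
  "closure_rule \<Sigma> R ps q \<Longrightarrow> wf_hyp \<Sigma> q \<Longrightarrow> (\<And>p. p \<in> set ps \<Longrightarrow> derives \<Sigma> R p) \<Longrightarrow> derives \<Sigma> R q"

inductive derives_mctx ::
    "'s signat \<Rightarrow> ('s, 'm, 'v) raw_rule set \<Rightarrow> ('s, 'm, 'v) mctx \<Rightarrow> bool"
  for \<Sigma> R where
  MCtx_Empty: "derives_mctx \<Sigma> R []"
| MCtx_Extend:
    "derives_mctx \<Sigma> R \<Theta> \<Longrightarrow> derives \<Sigma> R (Bdry \<Theta> [] B) \<Longrightarrow> M \<notin> ctx_dom \<Theta> \<Longrightarrow>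
     derives_mctx \<Sigma> R (\<Theta> @ [(M, B)])"

inductive derives_vctx ::
    "'s signat \<Rightarrow> ('s, 'm, 'v) raw_rule set \<Rightarrow> ('s, 'm, 'v) mctx \<Rightarrow> ('s, 'm, 'v) vctx \<Rightarrow> bool"
  for \<Sigma> R \<Theta> where
  VCtx_Empty: "derives_vctx \<Sigma> R \<Theta> []"
| VCtx_Extend:
    "derives_vctx \<Sigma> R \<Theta> \<Gamma> \<Longrightarrow> derives \<Sigma> R (Judg \<Theta> \<Gamma> (Plain (IsTy A))) \<Longrightarrow> a \<notin> ctx_dom \<Gamma> \<Longrightarrow>
     derives_vctx \<Sigma> R \<Theta> (\<Gamma> @ [(a, A)])"

end

theory Submission
  imports Defs
begin

text \<open>Induct on the derivation of the judgement. Specific rules and metavariable rules have the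
  boundary of their conclusion among their premises, and congruence rules at a term boundary have
  the equation between the two types as a premise, whose boundary is derivable by induction. The
  only rule that needs the context to be well-formed is the variable rule, where the type of a
  variable, derivable over an initial segment of the context, is weakened to the whole context.
  Since abstraction introduces a named fresh variable, weakening is proved simultaneously with
  renaming of free variables, which allows the fresh names to be chosen anew.\<close>

section \<open>Renaming free variables\<close>

text \<open>Here \<open>\<rho>\<close> is any map of names. Bound variables are indices, so nothing
  is captured and the same \<open>\<rho>\<close> acts under \<open>Lam\<close>.\<close>

fun ren :: "('v \<Rightarrow> 'v) \<Rightarrow> ('s, 'm, 'v) expr \<Rightarrow> ('s, 'm, 'v) expr" where
  "ren \<rho> (Free a) = Free (\<rho> a)"
| "ren \<rho> (Bound i) = Bound i"
| "ren \<rho> (Sym S es) = Sym S (map (ren \<rho>) es)"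
| "ren \<rho> (Meta M ts) = Meta M (map (ren \<rho>) ts)"
| "ren \<rho> StarTy = StarTy"
| "ren \<rho> StarTm = StarTm"
| "ren \<rho> (Lam e) = Lam (ren \<rho> e)"

abbreviation ren_judgement :: "('v \<Rightarrow> 'v) \<Rightarrow> ('s, 'm, 'v) judgement \<Rightarrow> ('s, 'm, 'v) judgement" where
  "ren_judgement \<rho> \<equiv> map_abstracted (ren \<rho>) (map_jthesis (ren \<rho>))"

abbreviation ren_boundary :: "('v \<Rightarrow> 'v) \<Rightarrow> ('s, 'm, 'v) boundary \<Rightarrow> ('s, 'm, 'v) boundary" where
  "ren_boundary \<rho> \<equiv> map_abstracted (ren \<rho>) (map_bthesis (ren \<rho>))"

section \<open>Compatibility of renaming with substitution, instantiation and filling\<close>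

lemma ren_id: "ren id = id"
proof
  show "ren id e = id e" for e :: "('s, 'm, 'v) expr"
    by (induction e) (auto intro: map_idI)
qed

lemma ren_lift: "ren \<rho> (lift k e) = lift k (ren \<rho> e)"
  by (induction e arbitrary: k) auto

lemma ren_up: "(\<lambda>i. ren \<rho> (up \<sigma> i)) = up (\<lambda>i. ren \<rho> (\<sigma> i))"
  by (rule ext) (auto simp: up_def ren_lift split: nat.split)

text \<open>Only the values of \<open>\<sigma>\<close> and the free variables of \<open>e\<close>
  are affected. The substitution is left general because it becomes \<open>up \<sigma>\<close> under
  \<open>Lam\<close>.\<close>

lemma ren_bsubst: "ren \<rho> (bsubst \<sigma> e) = bsubst (\<lambda>i. ren \<rho> (\<sigma> i)) (ren \<rho> e)"
  by (induction e arbitrary: \<sigma>) (auto simp: ren_up)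

lemma ren_tms: "(\<lambda>i. ren \<rho> (tms ts i)) = tms (map (ren \<rho>) ts)"
  by (rule ext) (auto simp: tms_def rev_map)

lemma ren_bsubst_tms: "ren \<rho> (bsubst (tms ts) e) = bsubst (tms (map (ren \<rho>) ts)) (ren \<rho> e)"
  by (simp add: ren_bsubst ren_tms)

lemma ren_bsubst_judgement:
  "ren_judgement \<rho> (bsubst_judgement \<sigma> J) = bsubst_judgement (\<lambda>i. ren \<rho> (\<sigma> i)) (ren_judgement \<rho> J)"
  by (induction J arbitrary: \<sigma>) (auto simp: ren_up ren_bsubst jthesis.map_comp comp_def)

lemma ren_bsubst_boundary:
  "ren_boundary \<rho> (bsubst_boundary \<sigma> B) = bsubst_boundary (\<lambda>i. ren \<rho> (\<sigma> i)) (ren_boundary \<rho> B)"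
  by (induction B arbitrary: \<sigma>) (auto simp: ren_up ren_bsubst bthesis.map_comp comp_def)

lemma ren_body: "ren \<rho> (body e) = body (ren \<rho> e)"
  by (cases e) auto

lemma ren_strip: "ren \<rho> (strip n e) = strip n (ren \<rho> e)"
  by (induction n arbitrary: e) (auto simp: ren_body)

text \<open>The arguments stored in \<open>I\<close> have free variables of their own, so they are
  renamed along with \<open>e\<close>. The \<open>Meta\<close> case combines commutation with
  \<open>strip\<close> and with \<open>tms\<close>.\<close>

lemma ren_act: "ren \<rho> (act I e) = act (\<lambda>M. map_option (ren \<rho>) (I M)) (ren \<rho> e)"
proof (induction e)
  case (Meta M ts)
  then have args: "map (ren \<rho>) (map (act I) ts) = map (act (\<lambda>M. map_option (ren \<rho>) (I M))) (map (ren \<rho>) ts)"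
    by simp
  then show ?case
    by (cases "I M") (simp_all only: act.simps ren.simps option.case option.map
        ren_bsubst_tms ren_strip args length_map)
qed auto

lemma ren_act_boundary:
  "ren_boundary \<rho> (act_boundary I B) = act_boundary (\<lambda>M. map_option (ren \<rho>) (I M)) (ren_boundary \<rho> B)"
  by (induction B) (auto simp: ren_act bthesis.map_comp comp_def)

lemma inst_map_ren: "inst_map \<Xi> (map (ren \<rho>) fs) = (\<lambda>M. map_option (ren \<rho>) (inst_map \<Xi> fs M))"
  by (simp add: inst_map_def zip_map2 map_of_map comp_def)

lemma map_fill_thesis: "map_jthesis f (fill_thesis b e) = fill_thesis (map_bthesis f b) (f e)"
  by (cases b) auto

lemma ren_fill: "ren_judgement \<rho> (fill B e) = fill (ren_boundary \<rho> B) (ren \<rho> e)"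
  by (induction B arbitrary: e) (auto simp: map_fill_thesis ren_body)

text \<open>At an equational boundary \<open>fill_eq_thesis\<close> is \<open>undefined\<close>,
  which need not commute with a map; hence the restriction to object classes.\<close>

lemma map_fill_eq_thesis:
  "obj_cls (bthesis_cls b) \<Longrightarrow>
     map_jthesis f (fill_eq_thesis b e e') = fill_eq_thesis (map_bthesis f b) (f e) (f e')"
  by (cases b) (auto simp: obj_cls_def)

lemma ren_fill_eq:
  "obj_bdry B \<Longrightarrow>
     ren_judgement \<rho> (fill_eq B e e') = fill_eq (ren_boundary \<rho> B) (ren \<rho> e) (ren \<rho> e')"
  by (induction B arbitrary: e e') (auto simp: map_fill_eq_thesis ren_body obj_bdry_def)

lemma bthesis_cls_map [simp]: "bthesis_cls (map_bthesis f b) = bthesis_cls b"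
  by (cases b) auto

lemma bdry_arity_act_boundary [simp]: "bdry_arity (act_boundary I B) = bdry_arity B"
  by (induction B) auto

section \<open>Syntactic validity under renaming, and dependence on the declared variables
  only\<close>

lemma wf_expr_ren:
  "wf_expr \<Sigma> \<mu> V k \<alpha> e \<Longrightarrow> \<rho> ` V \<subseteq> V' \<Longrightarrow> wf_expr \<Sigma> \<mu> V' k \<alpha> (ren \<rho> e)"
proof (induction rule: wf_expr.induct)
  case (3 S c \<alpha>s k es)
  then have "list_all2 (wf_expr \<Sigma> \<mu> V' k) \<alpha>s (map (ren \<rho>) es)"
    by (auto simp: list_all2_conv_all_nth)
  with 3 show ?case by (auto intro: wf_expr.intros)
next
  case (4 M c n ts k)
  then have "list_all (wf_expr \<Sigma> \<mu> V' k (Tm, 0)) (map (ren \<rho>) ts)"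
    by (auto simp: list_all_iff)
  with 4 show ?case by (auto intro: wf_expr.intros)
qed (auto intro: wf_expr.intros)

lemma wf_judgement_ren:
  "wf_judgement \<Sigma> \<mu> V k J \<Longrightarrow> \<rho> ` V \<subseteq> V' \<Longrightarrow> wf_judgement \<Sigma> \<mu> V' k (ren_judgement \<rho> J)"
proof (induction J arbitrary: k)
  case (Plain j)
  then show ?case by (cases j) (auto intro: wf_expr_ren)
qed (auto intro: wf_expr_ren)

lemma wf_boundary_ren:
  "wf_boundary \<Sigma> \<mu> V k B \<Longrightarrow> \<rho> ` V \<subseteq> V' \<Longrightarrow> wf_boundary \<Sigma> \<mu> V' k (ren_boundary \<rho> B)"
proof (induction B arbitrary: k)
  case (Plain b)
  then show ?case by (cases b) (auto intro: wf_expr_ren)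
qed (auto intro: wf_expr_ren)

text \<open>All free variables of a valid expression lie in \<open>V\<close>. This is applied with
  \<open>V\<close> empty, to fix closed syntax, and to change a renaming at a fresh name.\<close>

lemma ren_cong_wf_expr:
  "wf_expr \<Sigma> \<mu> V k \<alpha> e \<Longrightarrow> (\<And>a. a \<in> V \<Longrightarrow> \<rho> a = \<rho>' a) \<Longrightarrow> ren \<rho> e = ren \<rho>' e"
proof (induction rule: wf_expr.induct)
  case (3 S c \<alpha>s k es)
  then show ?case by (auto simp: list_all2_conv_all_nth in_set_conv_nth)
next
  case (4 M c n ts k)
  then show ?case by (auto simp: list_all_iff)
qed auto

lemma ren_cong_wf_jthesis:
  "wf_jthesis \<Sigma> \<mu> V k j \<Longrightarrow> (\<And>a. a \<in> V \<Longrightarrow> \<rho> a = \<rho>' a) \<Longrightarrow>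
     map_jthesis (ren \<rho>) j = map_jthesis (ren \<rho>') j"
  by (cases j) (auto elim!: ren_cong_wf_expr)

lemma ren_cong_wf_judgement:
  "wf_judgement \<Sigma> \<mu> V k J \<Longrightarrow> (\<And>a. a \<in> V \<Longrightarrow> \<rho> a = \<rho>' a) \<Longrightarrow>
     ren_judgement \<rho> J = ren_judgement \<rho>' J"
  by (induction J arbitrary: k) (auto elim!: ren_cong_wf_expr ren_cong_wf_jthesis)

lemma ren_cong_wf_boundary:
  "wf_boundary \<Sigma> \<mu> V k B \<Longrightarrow> (\<And>a. a \<in> V \<Longrightarrow> \<rho> a = \<rho>' a) \<Longrightarrow>
     ren_boundary \<rho> B = ren_boundary \<rho>' B"
proof (induction B arbitrary: k)
  case (Plain b)
  then show ?case by (cases b) (auto elim!: ren_cong_wf_expr)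
qed (auto elim!: ren_cong_wf_expr)

section \<open>Invariance of closed syntax and of metavariable contexts\<close>

lemma ren_closed_boundary: "wf_boundary \<Sigma> \<mu> {} k B \<Longrightarrow> ren_boundary \<rho> B = B"
  using ren_cong_wf_boundary[of \<Sigma> \<mu> "{}" k B \<rho> id]
  by (simp add: ren_id jthesis.map_id0 bthesis.map_id0 abstracted.map_id)

lemma ren_closed_jthesis: "wf_jthesis \<Sigma> \<mu> {} k j \<Longrightarrow> map_jthesis (ren \<rho>) j = j"
  using ren_cong_wf_jthesis[of \<Sigma> \<mu> "{}" k j \<rho> id] by (simp add: ren_id jthesis.map_id)

lemma ren_mctx_boundary:
  assumes "wf_mctx \<Sigma> \<Theta>" "(M, B) \<in> set \<Theta>"
  shows "ren_boundary \<rho> B = B"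
proof -
  from assms(2) obtain i where "i < length \<Theta>" "\<Theta> ! i = (M, B)"
    by (auto simp: in_set_conv_nth)
  with assms(1) have "wf_boundary \<Sigma> (mctx_arity (take i \<Theta>)) {} 0 B"
    by (auto simp: wf_mctx_def)
  then show ?thesis by (rule ren_closed_boundary)
qed

lemma map_abstracted_foldr_Abstr:
  "map_abstracted f g (foldr Abstr As (Plain b)) = foldr Abstr (map f As) (Plain (g b))"
  by (induction As) auto

lemma foldr_Abstr_inject:
  "foldr Abstr As (Plain b) = foldr Abstr As' (Plain b') \<longleftrightarrow> As = As' \<and> b = b'"
proof (induction As arbitrary: As')
  case Nil
  then show ?case by (cases As') auto
next
  case (Cons A As)
  then show ?case by (cases As') auto
qed

text \<open>The metavariable rules take a boundary apart into argument types and a thesis, so its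
  invariance is split into that of the components.\<close>

lemma ren_mctx_telescope:
  assumes "wf_mctx \<Sigma> \<Theta>" "(M, foldr Abstr As (Plain b)) \<in> set \<Theta>"
  shows "map (ren \<rho>) As = As" "map_bthesis (ren \<rho>) b = b"
  using ren_mctx_boundary[OF assms, of \<rho>]
  by (simp_all add: map_abstracted_foldr_Abstr foldr_Abstr_inject)


section \<open>Weakening\<close>

lemma derives_imp_wf_hyp: "derives \<Sigma> R h \<Longrightarrow> wf_hyp \<Sigma> h"
  by (auto elim: derives.cases)

lemma wf_vctx_snoc:
  "wf_vctx \<Sigma> \<Theta> \<Gamma> \<Longrightarrow> a \<notin> ctx_dom \<Gamma> \<Longrightarrow> wf_expr \<Sigma> (mctx_arity \<Theta>) (ctx_dom \<Gamma>) 0 (Ty, 0) A \<Longrightarrow>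
     wf_vctx \<Sigma> \<Theta> (\<Gamma> @ [(a, A)])"
  by (auto simp: wf_vctx_def ctx_dom_def less_Suc_eq nth_append)

text \<open>\<open>V\<close> is the domain of the part of the context that precedes the
  declaration.\<close>

lemma wf_vctx_type:
  assumes "wf_vctx \<Sigma> \<Theta> \<Gamma>" "(a, A) \<in> set \<Gamma>"
  obtains V where "V \<subseteq> ctx_dom \<Gamma>" "wf_expr \<Sigma> (mctx_arity \<Theta>) V 0 (Ty, 0) A"
proof -
  from assms(2) obtain i where "i < length \<Gamma>" "\<Gamma> ! i = (a, A)"
    by (auto simp: in_set_conv_nth)
  with assms(1) have "wf_expr \<Sigma> (mctx_arity \<Theta>) (ctx_dom (take i \<Gamma>)) 0 (Ty, 0) A"
    by (auto simp: wf_vctx_def)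
  moreover have "ctx_dom (take i \<Gamma>) \<subseteq> ctx_dom \<Gamma>"
    by (auto simp: ctx_dom_def dest: in_set_takeD)
  ultimately show thesis using that by blast
qed

text \<open>The target context may contain further declarations, so that renaming along the identity is
  weakening.\<close>

definition ren_into :: "('v \<Rightarrow> 'v) \<Rightarrow> ('s, 'm, 'v) vctx \<Rightarrow> ('s, 'm, 'v) vctx \<Rightarrow> bool" where
  "ren_into \<rho> \<Gamma> \<Gamma>' \<longleftrightarrow> (\<forall>(a, A) \<in> set \<Gamma>. (\<rho> a, ren \<rho> A) \<in> set \<Gamma>')"

lemma ren_into_ctx_dom: "ren_into \<rho> \<Gamma> \<Gamma>' \<Longrightarrow> \<rho> ` ctx_dom \<Gamma> \<subseteq> ctx_dom \<Gamma>'"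
  by (force simp: ren_into_def ctx_dom_def)

text \<open>This carries a renaming under a binder. Neither \<open>A\<close> nor a type in
  \<open>\<Gamma>\<close> mentions the fresh name \<open>a\<close>, so redirecting \<open>a\<close>
  to \<open>a'\<close> leaves their renamings unchanged.\<close>

lemma ren_into_snoc:
  assumes "wf_vctx \<Sigma> \<Theta> \<Gamma>" "a \<notin> ctx_dom \<Gamma>"
    and "wf_expr \<Sigma> (mctx_arity \<Theta>) (ctx_dom \<Gamma>) 0 (Ty, 0) A" "ren_into \<rho> \<Gamma> \<Gamma>'"
  shows "ren_into (\<rho>(a := a')) (\<Gamma> @ [(a, A)]) (\<Gamma>' @ [(a', ren \<rho> A)])"
proof -
  have "ren (\<rho>(a := a')) A = ren \<rho> A"
    using assms(2,3) by (auto elim!: ren_cong_wf_expr)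
  moreover have "((\<rho>(a := a')) x, ren (\<rho>(a := a')) X) \<in> set \<Gamma>'" if x: "(x, X) \<in> set \<Gamma>" for x X
  proof -
    from wf_vctx_type[OF assms(1) x] obtain V
      where "V \<subseteq> ctx_dom \<Gamma>" "wf_expr \<Sigma> (mctx_arity \<Theta>) V 0 (Ty, 0) X" .
    then have "ren (\<rho>(a := a')) X = ren \<rho> X"
      using assms(2) by (auto elim!: ren_cong_wf_expr)
    moreover have "x \<noteq> a" using x assms(2) by (force simp: ctx_dom_def)
    ultimately show ?thesis using x assms(4) by (auto simp: ren_into_def)
  qed
  ultimately show ?thesis by (auto simp: ren_into_def)
qed

text \<open>Contexts are finite lists; this is how the infinity of the type of names enters.\<close>

lemma ex_fresh_var: "\<exists>a. a \<notin> ctx_dom (\<Gamma> :: ('s, 'm, 'v::infinite) vctx)"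
  by (rule ex_new_if_finite) (auto simp: ctx_dom_def infinite_UNIV)

section \<open>Stability of the closure rules under renaming\<close>

fun hyp_vctx :: "('s, 'm, 'v) hyp \<Rightarrow> ('s, 'm, 'v) vctx" where
  "hyp_vctx (Judg \<Theta> \<Gamma> J) = \<Gamma>"
| "hyp_vctx (Bdry \<Theta> \<Gamma> B) = \<Gamma>"

fun hyp_mctx :: "('s, 'm, 'v) hyp \<Rightarrow> ('s, 'm, 'v) mctx" where
  "hyp_mctx (Judg \<Theta> \<Gamma> J) = \<Theta>"
| "hyp_mctx (Bdry \<Theta> \<Gamma> B) = \<Theta>"

text \<open>The context is replaced by \<open>\<Gamma>'\<close> outright, since the target may
  contain more than the renamed declarations.\<close>

fun ren_hyp :: "('v \<Rightarrow> 'v) \<Rightarrow> ('s, 'm, 'v) vctx \<Rightarrow> ('s, 'm, 'v) hyp \<Rightarrow> ('s, 'm, 'v) hyp" where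
  "ren_hyp \<rho> \<Gamma>' (Judg \<Theta> \<Gamma> J) = Judg \<Theta> \<Gamma>' (ren_judgement \<rho> J)"
| "ren_hyp \<rho> \<Gamma>' (Bdry \<Theta> \<Gamma> B) = Bdry \<Theta> \<Gamma>' (ren_boundary \<rho> B)"

lemma wf_hyp_ren:
  "wf_hyp \<Sigma> h \<Longrightarrow> ren_into \<rho> (hyp_vctx h) \<Gamma>' \<Longrightarrow> wf_vctx \<Sigma> (hyp_mctx h) \<Gamma>' \<Longrightarrow>
     wf_hyp \<Sigma> (ren_hyp \<rho> \<Gamma>' h)"
  by (cases h) (auto intro: wf_judgement_ren wf_boundary_ren dest: ren_into_ctx_dom)

lemma instantiation_of_ren:
  "instantiation_of \<Sigma> \<Theta> \<Gamma> \<Xi> fs \<Longrightarrow> ren_into \<rho> \<Gamma> \<Gamma>' \<Longrightarrow>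
     instantiation_of \<Sigma> \<Theta> \<Gamma>' \<Xi> (map (ren \<rho>) fs)"
  unfolding instantiation_of_def
  by (auto simp: list_all2_conv_all_nth split_beta intro!: wf_expr_ren[OF _ ren_into_ctx_dom])

lemma inst_bdry_ren:
  assumes "wf_mctx \<Sigma> \<Xi>" "i < length \<Xi>"
  shows "inst_bdry \<Xi> (map (ren \<rho>) fs) i = ren_boundary \<rho> (inst_bdry \<Xi> fs i)"
proof -
  have "ren_boundary \<rho> (snd (\<Xi> ! i)) = snd (\<Xi> ! i)"
    using ren_mctx_boundary[OF assms(1), of "fst (\<Xi> ! i)"] assms(2) by simp
  then show ?thesis by (simp add: inst_bdry_def ren_act_boundary inst_map_ren)
qed

text \<open>A filled object boundary records its head, so boundary and head can both be recovered. A
  filled equational boundary gives back the boundary alone, as in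
  \<open>map_bthesis_fixed\<close>.\<close>

lemma map_fill_thesis_fixed:
  assumes "obj_cls (bthesis_cls b)" "map_jthesis f (fill_thesis b e) = fill_thesis b e"
  shows "map_bthesis f b = b" "f e = e"
  using assms by (cases b; simp add: obj_cls_def)+

lemma map_bthesis_fixed:
  "map_jthesis f (fill_thesis b e) = fill_thesis b e \<Longrightarrow> map_bthesis f b = b"
  by (cases b) auto

lemma ren_jthesis_act:
  "map_jthesis (ren \<rho>) (map_jthesis (act (inst_map \<Xi> fs)) j) =
     map_jthesis (act (inst_map \<Xi> (map (ren \<rho>) fs))) (map_jthesis (ren \<rho>) j)"
  by (simp add: jthesis.map_comp comp_def ren_act inst_map_ren)

lemma ren_bthesis_act:
  "map_bthesis (ren \<rho>) (map_bthesis (act (inst_map \<Xi> fs)) b) =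
     map_bthesis (act (inst_map \<Xi> (map (ren \<rho>) fs))) (map_bthesis (ren \<rho>) b)"
  by (simp add: bthesis.map_comp comp_def ren_act inst_map_ren)

lemma ren_bthesis_bsubst_tms:
  "map_bthesis (ren \<rho>) (map_bthesis (bsubst (tms ts)) b) =
     map_bthesis (bsubst (tms (map (ren \<rho>) ts))) (map_bthesis (ren \<rho>) b)"
  by (simp add: bthesis.map_comp comp_def ren_bsubst_tms)

text \<open>The condition on the premises excludes the two abstraction rules, whose second premise
  extends the context. The other rules are schematic in the context and in the terms, while
  metavariable contexts and raw rules are closed.\<close>

lemma closure_rule_ren:
  assumes "closure_rule \<Sigma> R ps q" "raw_type_theory \<Sigma> R" "wf_hyp \<Sigma> q"
    and "ren_into \<rho> (hyp_vctx q) \<Gamma>'" "\<forall>p \<in> set ps. hyp_vctx p = hyp_vctx q"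
  shows "closure_rule \<Sigma> R (map (ren_hyp \<rho> \<Gamma>') ps) (ren_hyp \<rho> \<Gamma>' q)"
  using assms
proof cases
  case (TT_Var a A \<Gamma> \<Theta>)
  with assms(4) show ?thesis by (auto simp: ren_into_def intro: closure_rule.TT_Var)
next
  case (TT_Meta M As b \<Theta> ts \<Gamma>)
  \<comment> \<open>Boundaries in \<open>\<Theta>\<close> are closed, so \<open>As\<close> and
    \<open>b\<close> are fixed and only the arguments \<open>ts\<close> are renamed.\<close>
  from assms(3) TT_Meta have "wf_mctx \<Sigma> \<Theta>" by simp
  note closed = ren_mctx_telescope[OF this TT_Meta(3), of \<rho>]
  have As: "ren \<rho> (As ! j) = As ! j" if "j < length As" for j
    using that closed(1) by (metis nth_map)
  show ?thesis
    using closure_rule.TT_Meta[OF TT_Meta(3), of "map (ren \<rho>) ts" \<Sigma> R \<Gamma>'] TT_Meta(4)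
    unfolding TT_Meta(1,2)
    by (simp add: map_fill_thesis ren_bthesis_bsubst_tms closed(2) ren_bsubst_tms take_map As
        comp_def cong: list.map_cong_simp)
next
  case (TT_Meta_Congr M As b \<Theta> ss ts \<Gamma>)
  from assms(3) TT_Meta_Congr have "wf_mctx \<Sigma> \<Theta>" by simp
  note closed = ren_mctx_telescope[OF this TT_Meta_Congr(3), of \<rho>]
  have As: "ren \<rho> (As ! j) = As ! j" if "j < length As" for j
    using that closed(1) by (metis nth_map)
  have b: "map (ren_hyp \<rho> \<Gamma>') (case b of
           BTm C \<Rightarrow> [Judg \<Theta> \<Gamma> (Plain (EquTy (bsubst (tms ss) C) (bsubst (tms ts) C)))]
         | _ \<Rightarrow> []) =
      (case b of
           BTm C \<Rightarrow> [Judg \<Theta> \<Gamma>' (Plain (EquTy (bsubst (tms (map (ren \<rho>) ss)) C)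
                                            (bsubst (tms (map (ren \<rho>) ts)) C)))]
         | _ \<Rightarrow> [])"
    using closed(2) by (auto simp: ren_bsubst_tms split: bthesis.split)
  show ?thesis
    using closure_rule.TT_Meta_Congr[OF TT_Meta_Congr(3,4),
        of "map (ren \<rho>) ss" "map (ren \<rho>) ts" \<Sigma> R \<Gamma>'] TT_Meta_Congr(4-6)
    unfolding TT_Meta_Congr(1,2) map_append b
    by (simp add: map_fill_eq_thesis ren_bthesis_bsubst_tms closed(2) ren_bsubst_tms take_map As
        comp_def cong: list.map_cong_simp)
next
  case (Specific \<Xi> b e \<Theta> \<Gamma> fs)
  \<comment> \<open>A raw rule lives over the empty variable context, so it has no names to rename;
    the renaming acts on the instantiation alone.\<close>
  from assms(2) Specific(3)
  have wf: "wf_mctx \<Sigma> \<Xi>" "wf_jthesis \<Sigma> (mctx_arity \<Xi>) {} 0 (fill_thesis b e)"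
    by (auto simp: raw_type_theory_def ctx_dom_def)
  from wf(2) have closed: "map_jthesis (ren \<rho>) (fill_thesis b e) = fill_thesis b e"
    by (rule ren_closed_jthesis)
  have len: "length fs = length \<Xi>"
    using Specific(4) by (auto simp: instantiation_of_def dest: list_all2_lengthD)
  have inst: "instantiation_of \<Sigma> \<Theta> \<Gamma>' \<Xi> (map (ren \<rho>) fs)"
    using Specific assms(4) by (auto intro: instantiation_of_ren)
  show ?thesis
    using closure_rule.Specific[OF Specific(3) inst]
    unfolding Specific(1,2)
    by (simp add: ren_jthesis_act ren_bthesis_act closed map_bthesis_fixed[OF closed]
        inst_bdry_ren[OF wf(1)] ren_fill len comp_def cong: list.map_cong_simp)
next
  case (Congruence \<Xi> b e \<Theta> \<Gamma> fs gs)
  from assms(2) Congruence(3)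
  have wf: "wf_mctx \<Sigma> \<Xi>" "wf_jthesis \<Sigma> (mctx_arity \<Xi>) {} 0 (fill_thesis b e)"
    by (auto simp: raw_type_theory_def ctx_dom_def)
  note closed = map_fill_thesis_fixed[OF Congruence(4) ren_closed_jthesis[OF wf(2), of \<rho>]]
  have len: "length fs = length \<Xi>" "length gs = length \<Xi>"
    using Congruence(5,6) by (auto simp: instantiation_of_def dest: list_all2_lengthD)
  have inst: "instantiation_of \<Sigma> \<Theta> \<Gamma>' \<Xi> (map (ren \<rho>) fs)"
    "instantiation_of \<Sigma> \<Theta> \<Gamma>' \<Xi> (map (ren \<rho>) gs)"
    using Congruence assms(4) by (auto intro: instantiation_of_ren)
  have b: "map (ren_hyp \<rho> \<Gamma>') (case b of
           BTm B \<Rightarrow> [Judg \<Theta> \<Gamma> (Plain (EquTy (act (inst_map \<Xi> fs) B) (act (inst_map \<Xi> gs) B)))]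
         | _ \<Rightarrow> []) =
      (case b of
           BTm B \<Rightarrow> [Judg \<Theta> \<Gamma>' (Plain (EquTy (act (inst_map \<Xi> (map (ren \<rho>) fs)) B)
                                            (act (inst_map \<Xi> (map (ren \<rho>) gs)) B)))]
         | _ \<Rightarrow> [])"
    using closed(1) by (auto simp: ren_act inst_map_ren split: bthesis.split)
  have fill_eqs: "map (ren_hyp \<rho> \<Gamma>')
        (map (\<lambda>i. Judg \<Theta> \<Gamma> (fill_eq (inst_bdry \<Xi> fs i) (fs ! i) (gs ! i)))
          (filter (\<lambda>i. obj_bdry (snd (\<Xi> ! i))) [0..<length \<Xi>])) =
      map (\<lambda>i. Judg \<Theta> \<Gamma>' (fill_eq (inst_bdry \<Xi> (map (ren \<rho>) fs) i)
            (map (ren \<rho>) fs ! i) (map (ren \<rho>) gs ! i)))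
          (filter (\<lambda>i. obj_bdry (snd (\<Xi> ! i))) [0..<length \<Xi>])"
  proof -
    \<comment> \<open>The filter keeps object metavariables only, and instantiation preserves
      arities, so \<open>fill_eq\<close> is never applied at an equational boundary.\<close>
    have "obj_bdry (inst_bdry \<Xi> fs i)" if "obj_bdry (snd (\<Xi> ! i))" for i
      using that by (simp add: obj_bdry_def inst_bdry_def)
    then show ?thesis by (auto simp: ren_fill_eq inst_bdry_ren[OF wf(1)] len)
  qed
  have fills: "map (ren_hyp \<rho> \<Gamma>')
        (map (\<lambda>i. Judg \<Theta> \<Gamma> (fill (inst_bdry \<Xi> hs i) (hs ! i))) [0..<length \<Xi>]) =
      map (\<lambda>i. Judg \<Theta> \<Gamma>' (fill (inst_bdry \<Xi> (map (ren \<rho>) hs) i) (map (ren \<rho>) hs ! i)))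
        [0..<length \<Xi>]"
    if "length hs = length \<Xi>" for hs
    using that by (auto simp: ren_fill inst_bdry_ren[OF wf(1)])
  have concl: "ren_hyp \<rho> \<Gamma>' q = Judg \<Theta> \<Gamma>' (Plain (fill_eq_thesis
        (map_bthesis (act (inst_map \<Xi> (map (ren \<rho>) fs))) b)
        (act (inst_map \<Xi> (map (ren \<rho>) fs)) e) (act (inst_map \<Xi> (map (ren \<rho>) gs)) e)))"
    using Congruence(4) unfolding Congruence(2)
    by (simp add: map_fill_eq_thesis ren_bthesis_act closed ren_act inst_map_ren)
  show ?thesis
    using closure_rule.Congruence[OF Congruence(3,4) inst]
    unfolding concl unfolding Congruence(1) map_append b fill_eqs fills[OF len(1)] fills[OF len(2)] .
qed (auto simp: ren_into_def intro: closure_rule.intros)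

section \<open>Admissibility of renaming and weakening\<close>

text \<open>Both \<open>\<rho>\<close> and \<open>\<Gamma>'\<close> are generalised in the
  induction, because an abstraction rule extends the target context and redirects its
  variable.\<close>

lemma derives_ren:
  fixes R :: "('s, 'm, 'v::infinite) raw_rule set"
  assumes "derives \<Sigma> R h" "raw_type_theory \<Sigma> R"
    and "ren_into \<rho> (hyp_vctx h) \<Gamma>'" "wf_vctx \<Sigma> (hyp_mctx h) \<Gamma>'"
  shows "derives \<Sigma> R (ren_hyp \<rho> \<Gamma>' h)"
  using assms(1,3,4)
proof (induction h arbitrary: \<rho> \<Gamma>' rule: derives.induct)
  case (1 ps q)
  have wf: "wf_hyp \<Sigma> (ren_hyp \<rho> \<Gamma>' q)"
    using 1(2,5,6) by (rule wf_hyp_ren)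
  \<comment> \<open>This settles every rule whose premises share the contexts of the conclusion,
    that is, all but the two abstraction rules.\<close>
  have regular: ?case
    if "\<And>p. p \<in> set ps \<Longrightarrow> hyp_vctx p = hyp_vctx q \<and> hyp_mctx p = hyp_mctx q"
  proof (rule derives.intros[OF closure_rule_ren[OF 1(1) assms(2) 1(2) 1(5)] wf])
    fix p' assume "p' \<in> set (map (ren_hyp \<rho> \<Gamma>') ps)"
    then obtain p where "p \<in> set ps" "p' = ren_hyp \<rho> \<Gamma>' p" by auto
    with 1(4)[of p \<rho> \<Gamma>'] 1(5,6) that[of p] show "derives \<Sigma> R p'" by simp
  qed (use that in simp)
  \<comment> \<open>The name chosen by an abstraction rule is fresh for the source context but may
    be declared in \<open>\<Gamma>'\<close>, so it is exchanged for \<open>a'\<close>.\<close>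
  obtain a' where a': "a' \<notin> ctx_dom \<Gamma>'" using ex_fresh_var by blast
  from 1(1) show ?case
  proof cases
    case (TT_Abstr a \<Gamma> \<Theta> A J)
    define \<rho>' where "\<rho>' = \<rho>(a := a')"
    have q: "wf_vctx \<Sigma> \<Theta> \<Gamma>" "wf_expr \<Sigma> (mctx_arity \<Theta>) (ctx_dom \<Gamma>) 0 (Ty, 0) A"
      "wf_judgement \<Sigma> (mctx_arity \<Theta>) (ctx_dom \<Gamma>) (Suc 0) J" "ren_into \<rho> \<Gamma> \<Gamma>'" "wf_vctx \<Sigma> \<Theta> \<Gamma>'"
      using 1(2,5,6) TT_Abstr by auto
    have A: "derives \<Sigma> R (Judg \<Theta> \<Gamma>' (Plain (IsTy (ren \<rho> A))))"
      using 1(4)[of "Judg \<Theta> \<Gamma> (Plain (IsTy A))" \<rho> \<Gamma>'] q TT_Abstr by auto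
    have into: "ren_into \<rho>' (\<Gamma> @ [(a, A)]) (\<Gamma>' @ [(a', ren \<rho> A)])"
      unfolding \<rho>'_def using TT_Abstr q by (intro ren_into_snoc)
    have "wf_vctx \<Sigma> \<Theta> (\<Gamma>' @ [(a', ren \<rho> A)])"
      using derives_imp_wf_hyp[OF A] a' by (intro wf_vctx_snoc) auto
    then have "derives \<Sigma> R (Judg \<Theta> (\<Gamma>' @ [(a', ren \<rho> A)])
        (ren_judgement \<rho>' (bsubst_judgement (tms [Free a]) J)))"
      using 1(4)[of "Judg \<Theta> (\<Gamma> @ [(a, A)]) (bsubst_judgement (tms [Free a]) J)"
          \<rho>' "\<Gamma>' @ [(a', ren \<rho> A)]"] into TT_Abstr by auto
    \<comment> \<open>\<open>J\<close> is valid over \<open>\<Gamma>\<close>, where \<open>a\<close>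
      is not declared. Hence the occurrences of \<open>a\<close> in the opened judgement come from
      \<open>tms [Free a]\<close>, and exactly these turn into \<open>a'\<close>.\<close>
    moreover have "ren_judgement \<rho>' J = ren_judgement \<rho> J"
      using q(3) TT_Abstr by (auto simp: \<rho>'_def elim!: ren_cong_wf_judgement)
    ultimately have "derives \<Sigma> R (Judg \<Theta> (\<Gamma>' @ [(a', ren \<rho> A)])
        (bsubst_judgement (tms [Free a']) (ren_judgement \<rho> J)))"
      by (simp add: ren_bsubst_judgement ren_tms \<rho>'_def)
    with A wf show ?thesis
      unfolding TT_Abstr(2) ren_hyp.simps abstracted.map
      by (intro derives.intros[OF closure_rule.TT_Abstr[OF a']]) auto
  next
    \<comment> \<open>The same argument with a boundary in place of the judgement.\<close>
    case (TT_Bdry_Abstr a \<Gamma> \<Theta> A B)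
    define \<rho>' where "\<rho>' = \<rho>(a := a')"
    have q: "wf_vctx \<Sigma> \<Theta> \<Gamma>" "wf_expr \<Sigma> (mctx_arity \<Theta>) (ctx_dom \<Gamma>) 0 (Ty, 0) A"
      "wf_boundary \<Sigma> (mctx_arity \<Theta>) (ctx_dom \<Gamma>) (Suc 0) B" "ren_into \<rho> \<Gamma> \<Gamma>'" "wf_vctx \<Sigma> \<Theta> \<Gamma>'"
      using 1(2,5,6) TT_Bdry_Abstr by auto
    have A: "derives \<Sigma> R (Judg \<Theta> \<Gamma>' (Plain (IsTy (ren \<rho> A))))"
      using 1(4)[of "Judg \<Theta> \<Gamma> (Plain (IsTy A))" \<rho> \<Gamma>'] q TT_Bdry_Abstr by auto
    have into: "ren_into \<rho>' (\<Gamma> @ [(a, A)]) (\<Gamma>' @ [(a', ren \<rho> A)])"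
      unfolding \<rho>'_def using TT_Bdry_Abstr q by (intro ren_into_snoc)
    have "wf_vctx \<Sigma> \<Theta> (\<Gamma>' @ [(a', ren \<rho> A)])"
      using derives_imp_wf_hyp[OF A] a' by (intro wf_vctx_snoc) auto
    then have "derives \<Sigma> R (Bdry \<Theta> (\<Gamma>' @ [(a', ren \<rho> A)])
        (ren_boundary \<rho>' (bsubst_boundary (tms [Free a]) B)))"
      using 1(4)[of "Bdry \<Theta> (\<Gamma> @ [(a, A)]) (bsubst_boundary (tms [Free a]) B)"
          \<rho>' "\<Gamma>' @ [(a', ren \<rho> A)]"] into TT_Bdry_Abstr by auto
    moreover have "ren_boundary \<rho>' B = ren_boundary \<rho> B"
      using q(3) TT_Bdry_Abstr by (auto simp: \<rho>'_def elim!: ren_cong_wf_boundary)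
    ultimately have "derives \<Sigma> R (Bdry \<Theta> (\<Gamma>' @ [(a', ren \<rho> A)])
        (bsubst_boundary (tms [Free a']) (ren_boundary \<rho> B)))"
      by (simp add: ren_bsubst_boundary ren_tms \<rho>'_def)
    with A wf show ?thesis
      unfolding TT_Bdry_Abstr(2) ren_hyp.simps abstracted.map
      by (intro derives.intros[OF closure_rule.TT_Bdry_Abstr[OF a']]) auto
  qed (rule regular; auto split: bthesis.splits)+
qed

text \<open>This is renaming along \<open>id\<close>. Declarations are compared as sets, so the
  added ones may stand anywhere in \<open>\<Gamma>'\<close>.\<close>

lemma weakening:
  fixes R :: "('s, 'm, 'v::infinite) raw_rule set"
  assumes "raw_type_theory \<Sigma> R" "derives \<Sigma> R (Judg \<Theta> \<Gamma> J)" "set \<Gamma> \<subseteq> set \<Gamma>'" "wf_vctx \<Sigma> \<Theta> \<Gamma>'"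
  shows "derives \<Sigma> R (Judg \<Theta> \<Gamma>' J)"
proof -
  have "ren_into id \<Gamma> \<Gamma>'" using assms(3) by (auto simp: ren_into_def ren_id)
  then show ?thesis
    using derives_ren[OF assms(2,1), of id \<Gamma>'] assms(4)
    by (simp add: ren_id jthesis.map_id0 abstracted.map_id)
qed

lemma derives_vctx_type:
  fixes R :: "('s, 'm, 'v::infinite) raw_rule set"
  assumes "raw_type_theory \<Sigma> R" "derives_vctx \<Sigma> R \<Theta> \<Gamma>" "(a, A) \<in> set \<Gamma>" "wf_vctx \<Sigma> \<Theta> \<Gamma>"
  shows "derives \<Sigma> R (Judg \<Theta> \<Gamma> (Plain (IsTy A)))"
proof -
  \<comment> \<open>\<open>\<Gamma>\<^sub>0\<close> is the context at the moment the declaration was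
    added. Collecting it first means that weakening is applied once, directly to the full
    context.\<close>
  from assms(2,3) have "\<exists>\<Gamma>\<^sub>0. set \<Gamma>\<^sub>0 \<subseteq> set \<Gamma> \<and> derives \<Sigma> R (Judg \<Theta> \<Gamma>\<^sub>0 (Plain (IsTy A)))"
  proof (induction rule: derives_vctx.induct)
    case (VCtx_Extend \<Gamma> B b)
    show ?case
    proof (cases "(a, A) \<in> set \<Gamma>")
      case True
      then obtain \<Gamma>\<^sub>0 where "set \<Gamma>\<^sub>0 \<subseteq> set \<Gamma>" "derives \<Sigma> R (Judg \<Theta> \<Gamma>\<^sub>0 (Plain (IsTy A)))"
        using VCtx_Extend.IH by blast
      then show ?thesis by (intro exI[of _ \<Gamma>\<^sub>0]) auto
    next
      case False
      with VCtx_Extend.hyps(2) VCtx_Extend.prems show ?thesis by (intro exI[of _ \<Gamma>]) auto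
    qed
  qed simp
  then obtain \<Gamma>\<^sub>0 where "set \<Gamma>\<^sub>0 \<subseteq> set \<Gamma>" "derives \<Sigma> R (Judg \<Theta> \<Gamma>\<^sub>0 (Plain (IsTy A)))" by blast
  then show ?thesis using weakening[OF assms(1) _ _ assms(4)] by simp
qed


section \<open>Presuppositivity\<close>

text \<open>Reading the boundary off a judgement, rather than presenting the judgement as a filling,
  lets the induction run over arbitrary judgements; \<open>judgement_bdry_fill\<close> leads back to
  fillings.\<close>

fun jthesis_bdry :: "'e jthesis \<Rightarrow> 'e bthesis" where
  "jthesis_bdry (IsTy A) = BTy"
| "jthesis_bdry (HasTy t A) = BTm A"
| "jthesis_bdry (EquTy A B) = BEquTy A B"
| "jthesis_bdry (EquTm s t A) = BEquTm s t A"

abbreviation judgement_bdry :: "('s, 'm, 'v) judgement \<Rightarrow> ('s, 'm, 'v) boundary" where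
  "judgement_bdry \<equiv> map_abstracted id jthesis_bdry"

lemma jthesis_bdry_fill [simp]: "jthesis_bdry (fill_thesis b e) = b"
  by (cases b) auto

lemma jthesis_bdry_map [simp]: "jthesis_bdry (map_jthesis f j) = map_bthesis f (jthesis_bdry j)"
  by (cases j) auto

lemma judgement_bdry_fill [simp]: "judgement_bdry (fill B e) = B"
  by (induction B arbitrary: e) auto

lemma judgement_bdry_bsubst:
  "judgement_bdry (bsubst_judgement \<sigma> J) = bsubst_boundary \<sigma> (judgement_bdry J)"
  by (induction J arbitrary: \<sigma>) auto

lemma wf_judgement_bdry:
  "wf_judgement \<Sigma> \<mu> V k J \<Longrightarrow> wf_boundary \<Sigma> \<mu> V k (judgement_bdry J)"
proof (induction J arbitrary: k)
  case (Plain j)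
  then show ?case by (cases j) auto
qed auto

text \<open>Exactly one closure rule concludes a boundary of this shape, so its derivation can be
  inverted; likewise for the two equational shapes below.\<close>

lemma derives_BTm_iff:
  "derives \<Sigma> R (Bdry \<Theta> \<Gamma> (Plain (BTm A))) \<longleftrightarrow> derives \<Sigma> R (Judg \<Theta> \<Gamma> (Plain (IsTy A)))"
proof
  assume "derives \<Sigma> R (Judg \<Theta> \<Gamma> (Plain (IsTy A)))"
  then show "derives \<Sigma> R (Bdry \<Theta> \<Gamma> (Plain (BTm A)))"
    by (intro derives.intros[OF closure_rule.TT_Bdry_Tm]) (auto dest: derives_imp_wf_hyp)
qed (erule derives.cases, erule closure_rule.cases, simp_all)

lemma derives_BEquTy_iff:
  "derives \<Sigma> R (Bdry \<Theta> \<Gamma> (Plain (BEquTy A B))) \<longleftrightarrow>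
     derives \<Sigma> R (Judg \<Theta> \<Gamma> (Plain (IsTy A))) \<and> derives \<Sigma> R (Judg \<Theta> \<Gamma> (Plain (IsTy B)))"
proof
  assume "derives \<Sigma> R (Judg \<Theta> \<Gamma> (Plain (IsTy A))) \<and> derives \<Sigma> R (Judg \<Theta> \<Gamma> (Plain (IsTy B)))"
  then show "derives \<Sigma> R (Bdry \<Theta> \<Gamma> (Plain (BEquTy A B)))"
    by (intro derives.intros[OF closure_rule.TT_Bdry_EqTy]) (auto dest: derives_imp_wf_hyp)
qed (erule derives.cases, erule closure_rule.cases, simp_all)

lemma derives_BEquTm_iff:
  "derives \<Sigma> R (Bdry \<Theta> \<Gamma> (Plain (BEquTm s t A))) \<longleftrightarrow>
     derives \<Sigma> R (Judg \<Theta> \<Gamma> (Plain (IsTy A))) \<and>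
     derives \<Sigma> R (Judg \<Theta> \<Gamma> (Plain (HasTy s A))) \<and> derives \<Sigma> R (Judg \<Theta> \<Gamma> (Plain (HasTy t A)))"
proof
  assume "derives \<Sigma> R (Judg \<Theta> \<Gamma> (Plain (IsTy A))) \<and>
     derives \<Sigma> R (Judg \<Theta> \<Gamma> (Plain (HasTy s A))) \<and> derives \<Sigma> R (Judg \<Theta> \<Gamma> (Plain (HasTy t A)))"
  then show "derives \<Sigma> R (Bdry \<Theta> \<Gamma> (Plain (BEquTm s t A)))"
    by (intro derives.intros[OF closure_rule.TT_Bdry_EqTm]) (auto dest: derives_imp_wf_hyp)
qed (erule derives.cases, erule closure_rule.cases, simp_all)

lemmas derives_bdry_iffs = derives_BTm_iff derives_BEquTy_iff derives_BEquTm_iff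

lemma derives_conv_tm:
  assumes "derives \<Sigma> R (Judg \<Theta> \<Gamma> (Plain (HasTy t A)))" "derives \<Sigma> R (Judg \<Theta> \<Gamma> (Plain (EquTy A B)))"
  shows "derives \<Sigma> R (Judg \<Theta> \<Gamma> (Plain (HasTy t B)))"
  using assms assms[THEN derives_imp_wf_hyp]
  by (intro derives.intros[OF closure_rule.TT_Conv_Tm[where A = A]]) auto

lemma derives_ty_sym:
  assumes "derives \<Sigma> R (Judg \<Theta> \<Gamma> (Plain (EquTy A B)))"
  shows "derives \<Sigma> R (Judg \<Theta> \<Gamma> (Plain (EquTy B A)))"
  using assms derives_imp_wf_hyp[OF assms]
  by (intro derives.intros[OF closure_rule.TT_Ty_Sym[where A = A]]) auto

text \<open>The two sides of a congruence rule are conclusions of the original rule; at a term boundary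
  the right-hand one has to be converted along the equation between the types.\<close>

lemma derives_fill_eq_bdry:
  assumes "obj_cls (bthesis_cls b)"
    and wf: "wf_hyp \<Sigma> (Judg \<Theta> \<Gamma> (Plain (fill_eq_thesis (map_bthesis f b) s t)))"
    and eq: "\<And>C. b = BTm C \<Longrightarrow>
      derives \<Sigma> R (Judg \<Theta> \<Gamma> (Plain (EquTy (f C) (g C)))) \<and>
      derives \<Sigma> R (Bdry \<Theta> \<Gamma> (Plain (BEquTy (f C) (g C))))"
    and s: "wf_hyp \<Sigma> (Judg \<Theta> \<Gamma> (Plain (fill_thesis (map_bthesis f b) s))) \<Longrightarrow>
      derives \<Sigma> R (Bdry \<Theta> \<Gamma> (Plain (map_bthesis f b))) \<Longrightarrow>
      derives \<Sigma> R (Judg \<Theta> \<Gamma> (Plain (fill_thesis (map_bthesis f b) s)))"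
    and t: "wf_hyp \<Sigma> (Judg \<Theta> \<Gamma> (Plain (fill_thesis (map_bthesis g b) t))) \<Longrightarrow>
      derives \<Sigma> R (Bdry \<Theta> \<Gamma> (Plain (map_bthesis g b))) \<Longrightarrow>
      derives \<Sigma> R (Judg \<Theta> \<Gamma> (Plain (fill_thesis (map_bthesis g b) t)))"
  shows "derives \<Sigma> R (Bdry \<Theta> \<Gamma> (Plain (jthesis_bdry (fill_eq_thesis (map_bthesis f b) s t))))"
proof (cases b)
  case BTy
  have "derives \<Sigma> R (Bdry \<Theta> \<Gamma> (Plain BTy))"
    using wf by (intro derives.intros[OF closure_rule.TT_Bdry_Ty]) auto
  with BTy wf s t show ?thesis by (auto simp: derives_bdry_iffs)
next
  case (BTm C)
  \<comment> \<open>Inverting the boundary of the type equation makes both types derivable, which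
    supplies the boundaries required by \<open>s\<close> and \<open>t\<close>. The reversed equation
    will convert \<open>t\<close> from \<open>g C\<close> to \<open>f C\<close>.\<close>
  from eq[OF BTm] have C: "derives \<Sigma> R (Judg \<Theta> \<Gamma> (Plain (IsTy (f C))))"
    "derives \<Sigma> R (Judg \<Theta> \<Gamma> (Plain (IsTy (g C))))"
    "derives \<Sigma> R (Judg \<Theta> \<Gamma> (Plain (EquTy (g C) (f C))))"
    by (auto simp: derives_bdry_iffs intro: derives_ty_sym)
  \<comment> \<open>The guard for \<open>t\<close> at \<open>g C\<close> needs validity of
    \<open>g C\<close>, whereas \<open>wf\<close> speaks of \<open>f C\<close> only.\<close>
  from derives_imp_wf_hyp[OF C(2)] have "derives \<Sigma> R (Judg \<Theta> \<Gamma> (Plain (HasTy t (g C))))"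
    using t C wf BTm by (auto simp: derives_bdry_iffs)
  moreover have "derives \<Sigma> R (Judg \<Theta> \<Gamma> (Plain (HasTy s (f C))))"
    using s C wf BTm by (auto simp: derives_bdry_iffs)
  ultimately show ?thesis using C BTm by (auto simp: derives_bdry_iffs intro: derives_conv_tm)
qed (use assms(1) in \<open>auto simp: obj_cls_def\<close>)

text \<open>The variable context is generalised, since the premise of an abstraction lies over a
  longer one; its well-formedness is therefore carried through the induction.\<close>

lemma presuppositivity:
  fixes R :: "('s, 'm, 'v::infinite) raw_rule set"
  assumes "raw_type_theory \<Sigma> R" "derives \<Sigma> R (Judg \<Theta> \<Gamma> J)" "derives_vctx \<Sigma> R \<Theta> \<Gamma>"
  shows "derives \<Sigma> R (Bdry \<Theta> \<Gamma> (judgement_bdry J))"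
  using assms(2,3)
proof (induction "Judg \<Theta> \<Gamma> J" arbitrary: \<Gamma> J rule: derives.induct)
  case (1 ps)
  have IH: "derives \<Sigma> R (Bdry \<Theta> \<Gamma> (judgement_bdry J'))" if "Judg \<Theta> \<Gamma> J' \<in> set ps" for J'
    using 1(4)[OF that 1(5)] .
  \<comment> \<open>Each premise over \<open>\<Gamma>\<close> is paired with its boundary. For a
    structural rule, inverting these boundaries provides the components of the boundary of the
    conclusion.\<close>
  then have prems: "\<forall>p\<in>set ps. derives \<Sigma> R p \<and>
      (\<forall>J'. p = Judg \<Theta> \<Gamma> J' \<longrightarrow> derives \<Sigma> R (Bdry \<Theta> \<Gamma> (judgement_bdry J')))"
    using 1(3) by blast
  have wf: "wf_vctx \<Sigma> \<Theta> \<Gamma>" "wf_mctx \<Sigma> \<Theta>" "wf_hyp \<Sigma> (Bdry \<Theta> \<Gamma> (judgement_bdry J))"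
    using 1(2) by (auto intro: wf_judgement_bdry)
  from 1(1) show ?case
  proof cases
    case (TT_Var a A)
    then show ?thesis
      using derives_vctx_type[OF assms(1) 1(5) _ wf(1)] by (auto simp: derives_bdry_iffs)
  next
    case (TT_Meta M As b ts)
    then show ?thesis using 1(3) by auto
  next
    case (TT_Meta_Congr M As b ss ts)
    show ?thesis
      unfolding TT_Meta_Congr(2) abstracted.map
    \<comment> \<open>The left side and the type of the conclusion use \<open>ss\<close>, the right
      side \<open>ts\<close>. Each side follows by \<open>TT_Meta\<close> from its own block of term
      premises, with the boundary premise supplied by the lemma.\<close>
    proof (rule derives_fill_eq_bdry[where g = "bsubst (tms ts)"])
      show "obj_cls (bthesis_cls b)" by fact
      show "wf_hyp \<Sigma> (Judg \<Theta> \<Gamma> (Plain (fill_eq_thesis (map_bthesis (bsubst (tms ss)) b)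
          (Meta M ss) (Meta M ts))))"
        using 1(2) TT_Meta_Congr(2) by simp
      show "derives \<Sigma> R (Judg \<Theta> \<Gamma> (Plain (EquTy (bsubst (tms ss) C) (bsubst (tms ts) C)))) \<and>
          derives \<Sigma> R (Bdry \<Theta> \<Gamma> (Plain (BEquTy (bsubst (tms ss) C) (bsubst (tms ts) C))))"
        if "b = BTm C" for C
        using that 1(3) IH[of "Plain (EquTy (bsubst (tms ss) C) (bsubst (tms ts) C))"]
          TT_Meta_Congr(1) by auto
    next
      assume *: "wf_hyp \<Sigma> (Judg \<Theta> \<Gamma> (Plain (fill_thesis (map_bthesis (bsubst (tms ss)) b) (Meta M ss))))"
        "derives \<Sigma> R (Bdry \<Theta> \<Gamma> (Plain (map_bthesis (bsubst (tms ss)) b)))"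
      show "derives \<Sigma> R (Judg \<Theta> \<Gamma> (Plain (fill_thesis (map_bthesis (bsubst (tms ss)) b) (Meta M ss))))"
        by (rule derives.intros[OF closure_rule.TT_Meta[OF TT_Meta_Congr(3,5)] *(1)])
          (use 1(3) *(2) TT_Meta_Congr(1) in auto)
    next
      assume *: "wf_hyp \<Sigma> (Judg \<Theta> \<Gamma> (Plain (fill_thesis (map_bthesis (bsubst (tms ts)) b) (Meta M ts))))"
        "derives \<Sigma> R (Bdry \<Theta> \<Gamma> (Plain (map_bthesis (bsubst (tms ts)) b)))"
      show "derives \<Sigma> R (Judg \<Theta> \<Gamma> (Plain (fill_thesis (map_bthesis (bsubst (tms ts)) b) (Meta M ts))))"
        by (rule derives.intros[OF closure_rule.TT_Meta[OF TT_Meta_Congr(3,6)] *(1)])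
          (use 1(3) *(2) TT_Meta_Congr(1) in auto)
    qed
  next
    case (TT_Abstr a A J')
    have A: "derives \<Sigma> R (Judg \<Theta> \<Gamma> (Plain (IsTy A)))" using 1(3) TT_Abstr by simp
    \<comment> \<open>Since \<open>A\<close> is derivable, the longer context is again well-formed
      and the induction hypothesis applies to it. Taking boundaries commutes with opening the
      binder, so the same \<open>a\<close> serves in \<open>TT_Bdry_Abstr\<close>.\<close>
    have "derives_vctx \<Sigma> R \<Theta> (\<Gamma> @ [(a, A)])"
      using 1(5) A TT_Abstr by (intro VCtx_Extend)
    then have "derives \<Sigma> R (Bdry \<Theta> (\<Gamma> @ [(a, A)]) (bsubst_boundary (tms [Free a]) (judgement_bdry J')))"
      using 1(4)[of "\<Gamma> @ [(a, A)]"] TT_Abstr(1) by (simp add: judgement_bdry_bsubst)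
    with A show ?thesis
      using wf(3) TT_Abstr by (auto intro: derives.intros[OF closure_rule.TT_Bdry_Abstr])
  next
    case (Specific \<Xi> b e fs)
    then show ?thesis using 1(3) by auto
  next
    case (Congruence \<Xi> b e fs gs)
    show ?thesis
      unfolding Congruence(2) abstracted.map
    \<comment> \<open>As for metavariables, with instantiations in place of substitutions:
      \<open>fs\<close> gives the left side and the type, \<open>gs\<close> the right side, each by
      the specific rule itself.\<close>
    proof (rule derives_fill_eq_bdry[where g = "act (inst_map \<Xi> gs)"])
      show "obj_cls (bthesis_cls b)" by fact
      show "wf_hyp \<Sigma> (Judg \<Theta> \<Gamma> (Plain (fill_eq_thesis (map_bthesis (act (inst_map \<Xi> fs)) b)
          (act (inst_map \<Xi> fs) e) (act (inst_map \<Xi> gs) e))))"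
        using 1(2) Congruence(2) by simp
      show "derives \<Sigma> R (Judg \<Theta> \<Gamma> (Plain (EquTy (act (inst_map \<Xi> fs) C) (act (inst_map \<Xi> gs) C)))) \<and>
          derives \<Sigma> R (Bdry \<Theta> \<Gamma> (Plain (BEquTy (act (inst_map \<Xi> fs) C) (act (inst_map \<Xi> gs) C))))"
        if "b = BTm C" for C
        using that 1(3) IH[of "Plain (EquTy (act (inst_map \<Xi> fs) C) (act (inst_map \<Xi> gs) C))"]
          Congruence(1) by auto
    next
      assume *: "wf_hyp \<Sigma> (Judg \<Theta> \<Gamma> (Plain (fill_thesis (map_bthesis (act (inst_map \<Xi> fs)) b)
          (act (inst_map \<Xi> fs) e))))"
        "derives \<Sigma> R (Bdry \<Theta> \<Gamma> (Plain (map_bthesis (act (inst_map \<Xi> fs)) b)))"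
      show "derives \<Sigma> R (Judg \<Theta> \<Gamma> (Plain (fill_thesis (map_bthesis (act (inst_map \<Xi> fs)) b)
          (act (inst_map \<Xi> fs) e))))"
        \<comment> \<open>\<open>Specific\<close> concludes an instantiated filling, while here
          boundary and head are instantiated separately.\<close>
        using * unfolding map_fill_thesis[symmetric]
        by (intro derives.intros[OF closure_rule.Specific[OF Congruence(3,5)]])
          (use 1(3) Congruence(1) in auto)
    next
      assume *: "wf_hyp \<Sigma> (Judg \<Theta> \<Gamma> (Plain (fill_thesis (map_bthesis (act (inst_map \<Xi> gs)) b)
          (act (inst_map \<Xi> gs) e))))"
        "derives \<Sigma> R (Bdry \<Theta> \<Gamma> (Plain (map_bthesis (act (inst_map \<Xi> gs)) b)))"
      show "derives \<Sigma> R (Judg \<Theta> \<Gamma> (Plain (fill_thesis (map_bthesis (act (inst_map \<Xi> gs)) b)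
          (act (inst_map \<Xi> gs) e))))"
        using * unfolding map_fill_thesis[symmetric]
        by (intro derives.intros[OF closure_rule.Specific[OF Congruence(3,6)]])
          (use 1(3) Congruence(1) in auto)
    qed
  next
    \<comment> \<open>Both terms are converted to \<open>B\<close>, which is a type by inverting the
      boundary of the type equation.\<close>
    case (TT_Conv_EqTm s t A B)
    with prems show ?thesis by (auto simp: derives_bdry_iffs intro: derives_conv_tm)
  qed (use prems in \<open>simp_all add: derives_bdry_iffs\<close>)
qed

theorem mainTheorem5:
  fixes \<Sigma> :: "'s signat"
    and R :: "('s, 'm::infinite, 'v::infinite) raw_rule set"
    and \<Theta> :: "('s, 'm, 'v) mctx"
    and \<Gamma> :: "('s, 'm, 'v) vctx"
    and \<B> :: "('s, 'm, 'v) boundary"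
    and e :: "('s, 'm, 'v) expr"
  assumes "raw_type_theory \<Sigma> R"
    and "derives_mctx \<Sigma> R \<Theta>"
    and "derives_vctx \<Sigma> R \<Theta> \<Gamma>"
    and "derives \<Sigma> R (Judg \<Theta> \<Gamma> (fill \<B> e))"
  shows "derives \<Sigma> R (Bdry \<Theta> \<Gamma> \<B>)"
  using presuppositivity[OF assms(1,4,3)] by simp

end
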